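(* Let $a\in\mathbb{Z}_+^n$, $b\in\mathbb{Z}_+$, and let $N\cup\{t\}$ be a generalized $(1,k)$-configuration with respect to the knapsack constraint $a^{\mathsf T}x\le b$. Let $n'$ be the smallest number such that the inequality $\sum_{i\in N}x_i\le n'$ is valid for the knapsack polytope $K=\operatorname{conv}(\{x\in\{0,1\}^n: a^{\mathsf T}x\le b\})$. Then the generalized $(1,k)$-configuration inequality $$(n'-k+1)\,x_t+\sum_{i\in N}x_i\le n'$$ is valid for $K$.
   Context: $\mathbb{Z}_+$ denotes the nonnegative integers. An inequality is valid for $K$ if it is satisfied by all points of $K$. A cover with respect to $a^{\mathsf T}x\le b$ is a set $C\subseteq\{1,\dots,n\}$ with $\sum_{i\in C}a_i>b$. For a nonnegative integer $k$, a set $N\cup\{t\}$ with $N\subsetneq\{1,\dots,n\}$, $t\in\{1,\dots,n\}\setminus N$ and $k\le|N|$ is a generalized $(1,k)$-configuration with respect to $a^{\mathsf T}x\le b$ if $Q\cup\{t\}$ is a cover for every $Q\subseteq N$ with $|Q|=k$. *)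

theory Defs
  imports "HOL-Analysis.Analysis"
begin

definition knapsack_set :: "nat ^ 'n \<Rightarrow> nat \<Rightarrow> (real ^ 'n) set" where
  "knapsack_set a b =
     {x. (\<forall>i. x $ i \<in> {0, 1}) \<and> (\<Sum>i\<in>UNIV. real (a $ i) * x $ i) \<le> real b}"

definition knapsack_polytope :: "nat ^ 'n \<Rightarrow> nat \<Rightarrow> (real ^ 'n) set" where
  "knapsack_polytope a b = convex hull (knapsack_set a b)"

text \<open>An inequality is represented as a predicate on points.\<close>

definition valid_for :: "(real ^ 'n \<Rightarrow> bool) \<Rightarrow> (real ^ 'n) set \<Rightarrow> bool" where
  "valid_for ineq K \<longleftrightarrow> (\<forall>x\<in>K. ineq x)"

definition cover :: "nat ^ 'n \<Rightarrow> nat \<Rightarrow> 'n set \<Rightarrow> bool" where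
  "cover a b C \<longleftrightarrow> (\<Sum>i\<in>C. a $ i) > b"

text \<open>The configuration \<open>N \<union> {t}\<close> is given by the pair \<open>N\<close>, \<open>t\<close>, since the two parts
  play different roles.\<close>

definition generalized_1k_configuration ::
    "nat ^ 'n \<Rightarrow> nat \<Rightarrow> nat \<Rightarrow> 'n set \<Rightarrow> 'n \<Rightarrow> bool" where
  "generalized_1k_configuration a b k N t \<longleftrightarrow>
     N \<subset> UNIV \<and> t \<in> UNIV - N \<and> k \<le> card N \<and>
     (\<forall>Q. Q \<subseteq> N \<and> card Q = k \<longrightarrow> cover a b (Q \<union> {t}))"

end

theory Submission
  imports Defs
begin

text \<open>Validity on the polytope need only be checked at the 0/1 points. If x_t = 0 the inequality
  is the one defining n'. If x_t = 1, then x has fewer than k ones on N, since k of them together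
  with t would form a cover, and the inequality reduces to (n' - k + 1) + (k - 1) \<le> n'.\<close>

text \<open>A sublevel set of a linear function is convex, so it contains \<open>S\<close> exactly
  when it contains the hull of \<open>S\<close>.\<close>

lemma valid_for_convex_hull_iff:
  fixes f :: "real ^ 'n \<Rightarrow> real"
  assumes "linear f"
  shows "valid_for (\<lambda>x. f x \<le> r) (convex hull S) \<longleftrightarrow> valid_for (\<lambda>x. f x \<le> r) S"
proof -
  have "convex (f -` {..r})"
    using assms by (intro convex_linear_vimage) auto
  then have "convex hull S \<subseteq> f -` {..r} \<longleftrightarrow> S \<subseteq> f -` {..r}"
    by (metis hull_minimal hull_subset subset_trans)
  then show ?thesis
    by (auto simp: valid_for_def)
qed

lemma sum_binary_eq_card:
  fixes x :: "real ^ 'n"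
  assumes "\<And>i. x $ i \<in> {0, 1}"
  shows "(\<Sum>i\<in>N. x $ i) = real (card {i \<in> N. x $ i = 1})"
proof -
  have "(\<Sum>i\<in>N. x $ i) = (\<Sum>i\<in>N. if x $ i = 1 then 1 else 0)"
  proof (intro sum.cong refl)
    fix i
    show "x $ i = (if x $ i = 1 then 1 else 0)"
      using assms[of i] by auto
  qed
  also have "\<dots> = real (card {i \<in> N. x $ i = 1})"
    by (simp flip: sum.inter_filter)
  finally show ?thesis .
qed

text \<open>Feasibility of the origin ensures that the maximum over the 0/1 points is taken over a
  nonempty set.\<close>

lemma zero_in_knapsack_set: "0 \<in> knapsack_set a b"
  by (simp add: knapsack_set_def)

text \<open>All terms of the knapsack sum are nonnegative, so the weight of \<open>C\<close> is at
  most the whole sum, hence at most \<open>b\<close>.\<close>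

lemma not_cover_of_knapsack_point:
  assumes "x \<in> knapsack_set a b" and "\<And>i. i \<in> C \<Longrightarrow> x $ i = 1"
  shows "\<not> cover a b C"
proof -
  have "real (\<Sum>i\<in>C. a $ i) = (\<Sum>i\<in>C. real (a $ i) * x $ i)"
    using assms(2) by simp
  also have "\<dots> \<le> (\<Sum>i\<in>UNIV. real (a $ i) * x $ i)"
  proof (rule sum_mono2)
    fix i
    have "x $ i \<in> {0, 1}"
      using assms(1) by (auto simp: knapsack_set_def)
    then show "0 \<le> real (a $ i) * x $ i"
      by auto
  qed auto
  also have "\<dots> \<le> real b"
    using assms(1) by (simp add: knapsack_set_def)
  finally show ?thesis
    unfolding cover_def by linarith
qed

lemma configuration_card_less:
  assumes "generalized_1k_configuration a b k N t" "x \<in> knapsack_set a b" "x $ t = 1"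
  shows "card {i \<in> N. x $ i = 1} < k"
proof (rule ccontr)
  assume "\<not> ?thesis"
  \<comment> \<open>The configuration speaks only of subsets of size exactly \<open>k\<close>, so
    the set of ones is cut down to that size.\<close>
  then obtain Q where "Q \<subseteq> {i \<in> N. x $ i = 1}" "card Q = k"
    by (meson not_less obtain_subset_with_card_n)
  then have "cover a b (Q \<union> {t})" "\<And>i. i \<in> Q \<union> {t} \<Longrightarrow> x $ i = 1"
    using assms(1,3) by (auto simp: generalized_1k_configuration_def)
  then show False
    using assms(2) not_cover_of_knapsack_point by blast
qed

text \<open>LEAST on the reals is meaningful only when a minimum exists; here it is the maximum of
  the left-hand side over the 0/1 points.\<close>

lemma valid_for_Least_knapsack_polytope:
  fixes a :: "nat ^ 'n" and b :: nat and N :: "'n set"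
  defines "P \<equiv> \<lambda>r :: real. valid_for (\<lambda>x. (\<Sum>i\<in>N. x $ i) \<le> r) (knapsack_polytope a b)"
  shows "P (LEAST r. P r)"
proof -
  let ?V = "(\<lambda>x. \<Sum>i\<in>N. x $ i) ` knapsack_set a b"
  have "linear (\<lambda>x :: real ^ 'n. \<Sum>i\<in>N. x $ i)"
    by (auto intro!: linearI simp: sum.distrib sum_distrib_left)
  \<comment> \<open>In this form \<open>P\<close> holds exactly for the upper bounds of
    \<open>?V\<close>, so its least element is the maximum of \<open>?V\<close>.\<close>
  then have P_iff: "P r \<longleftrightarrow> (\<forall>v\<in>?V. v \<le> r)" for r
    unfolding P_def knapsack_polytope_def
    by (subst valid_for_convex_hull_iff) (auto simp: valid_for_def)
  \<comment> \<open>At 0/1 points the sum counts ones, so it takes only finitely many values and the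
    maximum is attained.\<close>
  have "?V \<subseteq> real ` {..card N}"
  proof clarify
    fix x assume "x \<in> knapsack_set a b"
    then have "(\<Sum>i\<in>N. x $ i) = real (card {i \<in> N. x $ i = 1})"
      by (intro sum_binary_eq_card) (simp add: knapsack_set_def)
    moreover have "card {i \<in> N. x $ i = 1} \<le> card N"
      by (intro card_mono) auto
    ultimately show "(\<Sum>i\<in>N. x $ i) \<in> real ` {..card N}"
      by auto
  qed
  then have "finite ?V"
    by (rule finite_subset) simp
  moreover have "?V \<noteq> {}"
    using zero_in_knapsack_set by blast
  ultimately have "P (Max ?V)" "\<And>r. P r \<Longrightarrow> Max ?V \<le> r"
    unfolding P_iff by (auto simp del: image_is_empty)
  then show ?thesis
    by (rule LeastI2_order) simp
qed

theorem theorem6: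
  fixes a :: "nat ^ 'n" and b k :: nat and N :: "'n set" and t :: 'n and n' :: real
  assumes "generalized_1k_configuration a b k N t"
    and "n' = (LEAST r :: real. valid_for (\<lambda>x. (\<Sum>i\<in>N. x $ i) \<le> r) (knapsack_polytope a b))"
  shows "valid_for (\<lambda>x. (n' - real k + 1) * x $ t + (\<Sum>i\<in>N. x $ i) \<le> n') (knapsack_polytope a b)"
proof -
  have "valid_for (\<lambda>x. (\<Sum>i\<in>N. x $ i) \<le> n') (knapsack_polytope a b)"
    unfolding assms(2) by (rule valid_for_Least_knapsack_polytope)
  then have le: "(\<Sum>i\<in>N. x $ i) \<le> n'" if "x \<in> knapsack_set a b" for x
    using that by (simp add: valid_for_def knapsack_polytope_def hull_inc)
  \<comment> \<open>The coefficient of \<open>x $ t\<close> is constant in \<open>x\<close>, so the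
    target inequality also passes from the 0/1 points to their hull.\<close>
  have "linear (\<lambda>x :: real ^ 'n. (n' - real k + 1) * x $ t + (\<Sum>i\<in>N. x $ i))"
    by (auto intro!: linearI simp: sum.distrib sum_distrib_left distrib_left)
  moreover have "valid_for (\<lambda>x. (n' - real k + 1) * x $ t + (\<Sum>i\<in>N. x $ i) \<le> n') (knapsack_set a b)"
    unfolding valid_for_def
  proof
    fix x assume x: "x \<in> knapsack_set a b"
    then have binary: "x $ i \<in> {0, 1}" for i
      by (simp add: knapsack_set_def)
    show "(n' - real k + 1) * x $ t + (\<Sum>i\<in>N. x $ i) \<le> n'"
    proof (cases "x $ t = 1")
      case True
      then have "card {i \<in> N. x $ i = 1} < k"
        using assms(1) x by (intro configuration_card_less)
      \<comment> \<open>Here \<open>n'\<close> cancels, leaving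
        \<open>card {i \<in> N. x $ i = 1} + 1 \<le> k\<close>, which is the strict bound read over
        the integers.\<close>
      then show ?thesis
        using sum_binary_eq_card[of x N] binary True by simp
    next
      case False
      then show ?thesis
        using binary[of t] le[OF x] by simp
    qed
  qed
  ultimately show ?thesis
    unfolding knapsack_polytope_def by (subst valid_for_convex_hull_iff)
qed

end
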